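(* Let $a,b,p,q$ be real numbers with $p^2+4q>0$, and let $\alpha,\beta$ be the roots of $t^{2}-pt-q=0$ with $\alpha-\beta=\sqrt{p^2+4q}$. Put $A=b-a\beta$, $B=b-a\alpha$, $\underline{\boldsymbol{\alpha}}=1+\alpha \mathbf{i}+\alpha^{2} \boldsymbol{\varepsilon}+\alpha^{3} \mathbf{h}$ and $\underline{\boldsymbol{\beta}}=1+\beta \mathbf{i}+\beta^{2} \boldsymbol{\varepsilon}+\beta^{3} \mathbf{h}$. Then for every integer $n\ge 0$ the $n$-th generalized hybrid Fibonacci number is $$\mathbb{H}\mathcal{J}_{n}=\frac{A\underline{\boldsymbol{\alpha}}\alpha^{n}-B\underline{\boldsymbol{\beta}}\beta^{n}}{\alpha-\beta}.$$ Moreover, if $a=0$ and $b=1$, then $\mathbb{H}\mathcal{J}_n$ is the hybrid $(p,q)$-Fibonacci number $\mathbb{H}\mathcal{F}_{n}$, and if $a=2$ and $b=p$, then $\mathbb{H}\mathcal{J}_n$ is the hybrid $(p,q)$-Lucas number $\mathbb{H}\mathcal{L}_{n}$.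
   Context: The hybrid numbers $\mathbb{K}$ are the 4-dimensional associative unital real algebra with basis $1,\mathbf{i},\boldsymbol{\varepsilon},\mathbf{h}$ and multiplication $\mathbf{i}^2=-1$, $\boldsymbol{\varepsilon}^2=0$, $\mathbf{h}^2=1$, $\mathbf{i}\boldsymbol{\varepsilon}=1-\mathbf{h}$, $\boldsymbol{\varepsilon}\mathbf{i}=1+\mathbf{h}$, $\mathbf{i}\mathbf{h}=\boldsymbol{\varepsilon}+\mathbf{i}$, $\mathbf{h}\mathbf{i}=-(\boldsymbol{\varepsilon}+\mathbf{i})$, $\boldsymbol{\varepsilon}\mathbf{h}=-\boldsymbol{\varepsilon}$, $\mathbf{h}\boldsymbol{\varepsilon}=\boldsymbol{\varepsilon}$. The generalized hybrid Fibonacci numbers with real parameters $a,b,p,q$ are defined by $\mathbb{H}\mathcal{J}_{n}=p\mathbb{H}\mathcal{J}_{n-1}+q\mathbb{H}\mathcal{J}_{n-2}$ for $n\ge 2$, with $\mathbb{H}\mathcal{J}_{0}=a+b\mathbf{i}+(pb+qa)\boldsymbol{\varepsilon}+((p^{2}+q)b+pqa)\mathbf{h}$ and $\mathbb{H}\mathcal{J}_{1}=b+(pb+qa)\mathbf{i}+((p^{2}+q)b+pqa)\boldsymbol{\varepsilon}+((p^{3}+2pq)b+q(p^{2}+q)a)\mathbf{h}$. The $(p,q)$-Fibonacci numbers: $\mathcal{F}_0=0$, $\mathcal{F}_1=1$, $\mathcal{F}_n=p\mathcal{F}_{n-1}+q\mathcal{F}_{n-2}$. The $(p,q)$-Lucas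 numbers: $\mathcal{L}_0=2$, $\mathcal{L}_1=p$, $\mathcal{L}_n=p\mathcal{L}_{n-1}+q\mathcal{L}_{n-2}$. The hybrid versions are $\mathbb{H}\mathcal{F}_{n}=\mathcal{F}_{n}+\mathcal{F}_{n+1}\mathbf{i}+\mathcal{F}_{n+2}\boldsymbol{\varepsilon}+\mathcal{F}_{n+3}\mathbf{h}$ and $\mathbb{H}\mathcal{L}_{n}=\mathcal{L}_{n}+\mathcal{L}_{n+1}\mathbf{i}+\mathcal{L}_{n+2}\boldsymbol{\varepsilon}+\mathcal{L}_{n+3}\mathbf{h}$. Convention: $x^0=1$ for every real $x$, including $x=0$. *)

theory Defs
  imports Complex_Main
begin

text \<open>\<open>Hybrid w x y z\<close> stands for \<open>w + x i + y eps + z h\<close>, see \<open>hybrid_expand\<close> below.\<close>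

datatype hybrid = Hybrid (hcoeff_1: real) (hcoeff_i: real) (hcoeff_eps: real) (hcoeff_h: real)

lemma hybrid_eq_iff:
  "x = y \<longleftrightarrow> hcoeff_1 x = hcoeff_1 y \<and> hcoeff_i x = hcoeff_i y \<and>
    hcoeff_eps x = hcoeff_eps y \<and> hcoeff_h x = hcoeff_h y"
  by (cases x; cases y) simp

text \<open>The product is the bilinear extension of the multiplication table of the basis, which is
  recovered in \<open>hybrid_mult_table\<close> below.\<close>

instantiation hybrid :: real_algebra_1
begin

definition zero_hybrid :: hybrid where
  "0 = Hybrid 0 0 0 0"

definition one_hybrid :: hybrid where
  "1 = Hybrid 1 0 0 0"

definition plus_hybrid :: "hybrid \<Rightarrow> hybrid \<Rightarrow> hybrid" where
  "x + y = Hybrid (hcoeff_1 x + hcoeff_1 y) (hcoeff_i x + hcoeff_i y)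
                  (hcoeff_eps x + hcoeff_eps y) (hcoeff_h x + hcoeff_h y)"

definition uminus_hybrid :: "hybrid \<Rightarrow> hybrid" where
  "- x = Hybrid (- hcoeff_1 x) (- hcoeff_i x) (- hcoeff_eps x) (- hcoeff_h x)"

definition minus_hybrid :: "hybrid \<Rightarrow> hybrid \<Rightarrow> hybrid" where
  "x - y = Hybrid (hcoeff_1 x - hcoeff_1 y) (hcoeff_i x - hcoeff_i y)
                  (hcoeff_eps x - hcoeff_eps y) (hcoeff_h x - hcoeff_h y)"

definition scaleR_hybrid :: "real \<Rightarrow> hybrid \<Rightarrow> hybrid" where
  "c *\<^sub>R x = Hybrid (c * hcoeff_1 x) (c * hcoeff_i x) (c * hcoeff_eps x) (c * hcoeff_h x)"

definition times_hybrid :: "hybrid \<Rightarrow> hybrid \<Rightarrow> hybrid" where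
  "x * y = Hybrid
    (hcoeff_1 x * hcoeff_1 y - hcoeff_i x * hcoeff_i y + hcoeff_h x * hcoeff_h y
       + hcoeff_i x * hcoeff_eps y + hcoeff_eps x * hcoeff_i y)
    (hcoeff_1 x * hcoeff_i y + hcoeff_i x * hcoeff_1 y
       + hcoeff_i x * hcoeff_h y - hcoeff_h x * hcoeff_i y)
    (hcoeff_1 x * hcoeff_eps y + hcoeff_eps x * hcoeff_1 y
       + hcoeff_i x * hcoeff_h y - hcoeff_h x * hcoeff_i y
       - hcoeff_eps x * hcoeff_h y + hcoeff_h x * hcoeff_eps y)
    (hcoeff_1 x * hcoeff_h y + hcoeff_h x * hcoeff_1 y
       - hcoeff_i x * hcoeff_eps y + hcoeff_eps x * hcoeff_i y)"

instance
  by standard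
    (simp_all add: zero_hybrid_def one_hybrid_def plus_hybrid_def uminus_hybrid_def
      minus_hybrid_def scaleR_hybrid_def times_hybrid_def hybrid_eq_iff algebra_simps)

end

definition hybrid_i :: hybrid  ("\<^bold>i") where
  "\<^bold>i = Hybrid 0 1 0 0"

definition hybrid_eps :: hybrid  ("\<^bold>\<epsilon>") where
  "\<^bold>\<epsilon> = Hybrid 0 0 1 0"

definition hybrid_h :: hybrid  ("\<^bold>h") where
  "\<^bold>h = Hybrid 0 0 0 1"

lemma hybrid_mult_table:
  "\<^bold>i * \<^bold>i = - 1"        "\<^bold>i * \<^bold>\<epsilon> = 1 - \<^bold>h"    "\<^bold>i * \<^bold>h = \<^bold>\<epsilon> + \<^bold>i"
  "\<^bold>\<epsilon> * \<^bold>i = 1 + \<^bold>h"    "\<^bold>\<epsilon> * \<^bold>\<epsilon> = 0"        "\<^bold>\<epsilon> * \<^bold>h = - \<^bold>\<epsilon>"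
  "\<^bold>h * \<^bold>i = - (\<^bold>\<epsilon> + \<^bold>i)"  "\<^bold>h * \<^bold>\<epsilon> = \<^bold>\<epsilon>"       "\<^bold>h * \<^bold>h = 1"
  by (simp_all add: hybrid_i_def hybrid_eps_def hybrid_h_def zero_hybrid_def one_hybrid_def
      plus_hybrid_def uminus_hybrid_def minus_hybrid_def times_hybrid_def)

lemma hybrid_expand:
  "Hybrid w x y z = of_real w + x *\<^sub>R \<^bold>i + y *\<^sub>R \<^bold>\<epsilon> + z *\<^sub>R \<^bold>h"
  by (simp add: of_real_def hybrid_i_def hybrid_eps_def hybrid_h_def one_hybrid_def
      plus_hybrid_def scaleR_hybrid_def)

fun gen_hybrid_fib :: "real \<Rightarrow> real \<Rightarrow> real \<Rightarrow> real \<Rightarrow> nat \<Rightarrow> hybrid" where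
  "gen_hybrid_fib a b p q 0 =
     of_real a + b *\<^sub>R \<^bold>i + (p * b + q * a) *\<^sub>R \<^bold>\<epsilon> + ((p\<^sup>2 + q) * b + p * q * a) *\<^sub>R \<^bold>h"
| "gen_hybrid_fib a b p q (Suc 0) =
     of_real b + (p * b + q * a) *\<^sub>R \<^bold>i + ((p\<^sup>2 + q) * b + p * q * a) *\<^sub>R \<^bold>\<epsilon>
       + ((p ^ 3 + 2 * p * q) * b + q * (p\<^sup>2 + q) * a) *\<^sub>R \<^bold>h"
| "gen_hybrid_fib a b p q (Suc (Suc n)) =
     p *\<^sub>R gen_hybrid_fib a b p q (Suc n) + q *\<^sub>R gen_hybrid_fib a b p q n"

fun pq_fib :: "real \<Rightarrow> real \<Rightarrow> nat \<Rightarrow> real" where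
  "pq_fib p q 0 = 0"
| "pq_fib p q (Suc 0) = 1"
| "pq_fib p q (Suc (Suc n)) = p * pq_fib p q (Suc n) + q * pq_fib p q n"

fun pq_lucas :: "real \<Rightarrow> real \<Rightarrow> nat \<Rightarrow> real" where
  "pq_lucas p q 0 = 2"
| "pq_lucas p q (Suc 0) = p"
| "pq_lucas p q (Suc (Suc n)) = p * pq_lucas p q (Suc n) + q * pq_lucas p q n"

definition hybrid_pq_fib :: "real \<Rightarrow> real \<Rightarrow> nat \<Rightarrow> hybrid" where
  "hybrid_pq_fib p q n =
     of_real (pq_fib p q n) + pq_fib p q (n + 1) *\<^sub>R \<^bold>i
       + pq_fib p q (n + 2) *\<^sub>R \<^bold>\<epsilon> + pq_fib p q (n + 3) *\<^sub>R \<^bold>h"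

definition hybrid_pq_lucas :: "real \<Rightarrow> real \<Rightarrow> nat \<Rightarrow> hybrid" where
  "hybrid_pq_lucas p q n =
     of_real (pq_lucas p q n) + pq_lucas p q (n + 1) *\<^sub>R \<^bold>i
       + pq_lucas p q (n + 2) *\<^sub>R \<^bold>\<epsilon> + pq_lucas p q (n + 3) *\<^sub>R \<^bold>h"

end

theory Submission
  imports Defs
begin

text \<open>A sequence obeying x(n+2) = p x(n+1) + q x(n) is fixed by its first two terms
  (\<open>gen_hybrid_fib_unique\<close>), so each claimed formula need only obey the recurrence and
  agree at 0 and 1. For Binet's formula (\<open>gen_hybrid_fib_binet\<close>), Vieta gives p =
  \<alpha> + \<beta> and q = -\<alpha>\<beta>, so the powers of each root obey the recurrence, and
  so does any combination of them with constant hybrid coefficients. A and B are chosen to match the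
  initial values, whose coefficients are consecutive terms of the real sequence starting a, b.
  Hybrid multiplication never enters: all is linear and is checked on the four real
  coefficients.\<close>

lemma hcoeff_simps [simp]:
  "hcoeff_1 (x + y) = hcoeff_1 x + hcoeff_1 y" "hcoeff_i (x + y) = hcoeff_i x + hcoeff_i y"
  "hcoeff_eps (x + y) = hcoeff_eps x + hcoeff_eps y" "hcoeff_h (x + y) = hcoeff_h x + hcoeff_h y"
  "hcoeff_1 (x - y) = hcoeff_1 x - hcoeff_1 y" "hcoeff_i (x - y) = hcoeff_i x - hcoeff_i y"
  "hcoeff_eps (x - y) = hcoeff_eps x - hcoeff_eps y" "hcoeff_h (x - y) = hcoeff_h x - hcoeff_h y"
  "hcoeff_1 (c *\<^sub>R x) = c * hcoeff_1 x" "hcoeff_i (c *\<^sub>R x) = c * hcoeff_i x"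
  "hcoeff_eps (c *\<^sub>R x) = c * hcoeff_eps x" "hcoeff_h (c *\<^sub>R x) = c * hcoeff_h x"
  "hcoeff_1 1 = 1" "hcoeff_i 1 = 0" "hcoeff_eps 1 = 0" "hcoeff_h 1 = 0"
  "hcoeff_1 (of_real c) = c" "hcoeff_i (of_real c) = 0"
  "hcoeff_eps (of_real c) = 0" "hcoeff_h (of_real c) = 0"
  "hcoeff_1 \<^bold>i = 0" "hcoeff_i \<^bold>i = 1" "hcoeff_eps \<^bold>i = 0" "hcoeff_h \<^bold>i = 0"
  "hcoeff_1 \<^bold>\<epsilon> = 0" "hcoeff_i \<^bold>\<epsilon> = 0" "hcoeff_eps \<^bold>\<epsilon> = 1" "hcoeff_h \<^bold>\<epsilon> = 0"
  "hcoeff_1 \<^bold>h = 0" "hcoeff_i \<^bold>h = 0" "hcoeff_eps \<^bold>h = 0" "hcoeff_h \<^bold>h = 1"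
  by (simp_all add: of_real_def plus_hybrid_def minus_hybrid_def scaleR_hybrid_def one_hybrid_def
      hybrid_i_def hybrid_eps_def hybrid_h_def)

lemma gen_hybrid_fib_unique:
  assumes "f 0 = gen_hybrid_fib a b p q 0"
    and "f 1 = gen_hybrid_fib a b p q 1"
    and "\<And>n. f (Suc (Suc n)) = p *\<^sub>R f (Suc n) + q *\<^sub>R f n"
  shows "gen_hybrid_fib a b p q n = f n"
  by (induction n rule: induct_nat_012) (use assms in simp_all)

text \<open>Each coefficient of \<open>hybrid_pq_fib\<close> is a shift of \<open>pq_fib\<close>,
  hence obeys the same recurrence; the initial values list the terms 0 to 3 and 1 to 4.\<close>

lemma gen_hybrid_fib_eq_hybrid_pq_fib:
  "gen_hybrid_fib 0 1 p q n = hybrid_pq_fib p q n"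
  by (rule gen_hybrid_fib_unique)
    \<comment> \<open>\<open>of_real\<close> of a sum or product is kept whole: split, it would
      create hybrid products, which \<open>hcoeff_simps\<close> does not evaluate.\<close>
    (simp_all add: hybrid_pq_fib_def hybrid_eq_iff eval_nat_numeral algebra_simps
      del: of_real_add of_real_mult)

lemma gen_hybrid_fib_eq_hybrid_pq_lucas:
  "gen_hybrid_fib 2 p p q n = hybrid_pq_lucas p q n"
  by (rule gen_hybrid_fib_unique)
    (simp_all add: hybrid_pq_lucas_def hybrid_eq_iff eval_nat_numeral algebra_simps
      del: of_real_add of_real_mult)

text \<open>Taking p and q as symmetric functions of the roots avoids square roots: every check
  becomes a polynomial identity in a, b, \<alpha>, \<beta>.\<close>

lemma gen_hybrid_fib_binet:
  fixes a b p q \<alpha> \<beta> :: real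
  defines "\<alpha>h \<equiv> 1 + \<alpha> *\<^sub>R \<^bold>i + \<alpha>\<^sup>2 *\<^sub>R \<^bold>\<epsilon> + \<alpha> ^ 3 *\<^sub>R \<^bold>h"
    and "\<beta>h \<equiv> 1 + \<beta> *\<^sub>R \<^bold>i + \<beta>\<^sup>2 *\<^sub>R \<^bold>\<epsilon> + \<beta> ^ 3 *\<^sub>R \<^bold>h"
  assumes p: "p = \<alpha> + \<beta>" and q: "q = - (\<alpha> * \<beta>)" and neq: "\<alpha> \<noteq> \<beta>"
  shows "gen_hybrid_fib a b p q n =
    (((b - a * \<beta>) * \<alpha> ^ n) *\<^sub>R \<alpha>h - ((b - a * \<alpha>) * \<beta> ^ n) *\<^sub>R \<beta>h) /\<^sub>R (\<alpha> - \<beta>)"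
proof (rule gen_hybrid_fib_unique)
  \<comment> \<open>Clears the denominator in the two initial values, which rest on A - B =
    a(\<alpha> - \<beta>) and A\<alpha> - B\<beta> = b(\<alpha> - \<beta>).\<close>
  have cancel: "x /\<^sub>R (\<alpha> - \<beta>) = y \<longleftrightarrow> x = (\<alpha> - \<beta>) *\<^sub>R y" for x y :: hybrid
    using neq by auto
  show "(((b - a * \<beta>) * \<alpha> ^ 0) *\<^sub>R \<alpha>h - ((b - a * \<alpha>) * \<beta> ^ 0) *\<^sub>R \<beta>h) /\<^sub>R (\<alpha> - \<beta>)
      = gen_hybrid_fib a b p q 0"
    unfolding cancel \<alpha>h_def \<beta>h_def
    by (simp add: hybrid_eq_iff p q eval_nat_numeral algebra_simps)
  show "(((b - a * \<beta>) * \<alpha> ^ 1) *\<^sub>R \<alpha>h - ((b - a * \<alpha>) * \<beta> ^ 1) *\<^sub>R \<beta>h) /\<^sub>R (\<alpha> - \<beta>)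
      = gen_hybrid_fib a b p q 1"
    unfolding cancel \<alpha>h_def \<beta>h_def
    by (simp add: hybrid_eq_iff p q eval_nat_numeral algebra_simps)
  show "(((b - a * \<beta>) * \<alpha> ^ Suc (Suc m)) *\<^sub>R \<alpha>h - ((b - a * \<alpha>) * \<beta> ^ Suc (Suc m)) *\<^sub>R \<beta>h)
        /\<^sub>R (\<alpha> - \<beta>)
      = p *\<^sub>R ((((b - a * \<beta>) * \<alpha> ^ Suc m) *\<^sub>R \<alpha>h - ((b - a * \<alpha>) * \<beta> ^ Suc m) *\<^sub>R \<beta>h)
          /\<^sub>R (\<alpha> - \<beta>))
        + q *\<^sub>R ((((b - a * \<beta>) * \<alpha> ^ m) *\<^sub>R \<alpha>h - ((b - a * \<alpha>) * \<beta> ^ m) *\<^sub>R \<beta>h)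
          /\<^sub>R (\<alpha> - \<beta>))" for m
    \<comment> \<open>The inverse of \<alpha> - \<beta> is a common factor here, so it need not be
      cleared.\<close>
    by (simp add: hybrid_eq_iff p q algebra_simps)
qed

theorem theorem2p2:
  fixes a b p q \<alpha> \<beta> A B :: real
    and \<alpha>h \<beta>h :: hybrid
  assumes "p\<^sup>2 + 4 * q > 0"
    and "{t. t\<^sup>2 - p * t - q = 0} = {\<alpha>, \<beta>}"
    and "\<alpha> - \<beta> = sqrt (p\<^sup>2 + 4 * q)"
    and "A = b - a * \<beta>"
    and "B = b - a * \<alpha>"
    and "\<alpha>h = 1 + \<alpha> *\<^sub>R \<^bold>i + \<alpha>\<^sup>2 *\<^sub>R \<^bold>\<epsilon> + \<alpha> ^ 3 *\<^sub>R \<^bold>h"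
    and "\<beta>h = 1 + \<beta> *\<^sub>R \<^bold>i + \<beta>\<^sup>2 *\<^sub>R \<^bold>\<epsilon> + \<beta> ^ 3 *\<^sub>R \<^bold>h"
  shows "(\<forall>n. gen_hybrid_fib a b p q n =
            ((A * \<alpha> ^ n) *\<^sub>R \<alpha>h - (B * \<beta> ^ n) *\<^sub>R \<beta>h) /\<^sub>R (\<alpha> - \<beta>))
       \<and> (a = 0 \<and> b = 1 \<longrightarrow> (\<forall>n. gen_hybrid_fib a b p q n = hybrid_pq_fib p q n))
       \<and> (a = 2 \<and> b = p \<longrightarrow> (\<forall>n. gen_hybrid_fib a b p q n = hybrid_pq_lucas p q n))"
proof -
  have neq: "\<alpha> \<noteq> \<beta>" using assms(1,3) by auto
  have roots: "\<alpha>\<^sup>2 - p * \<alpha> - q = 0" "\<beta>\<^sup>2 - p * \<beta> - q = 0"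
    using assms(2) by blast+
  \<comment> \<open>Vieta: subtracting the two root equations leaves this product, and \<alpha>
    \<noteq> \<beta> gives the sum of the roots; substituting it back gives their product.\<close>
  then have "(\<alpha> - \<beta>) * (\<alpha> + \<beta> - p) = 0" by algebra
  then have p: "p = \<alpha> + \<beta>" using neq by simp
  have q: "q = - (\<alpha> * \<beta>)" using roots(1) p by algebra
  show ?thesis
    using gen_hybrid_fib_binet[OF p q neq] gen_hybrid_fib_eq_hybrid_pq_fib
      gen_hybrid_fib_eq_hybrid_pq_lucas assms(4-7) by blast
qed

end
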